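(* Let $X$ be a non-empty set and let $S\subseteq \mathrm{Der}(X)$ be finite and non-empty. Then the derangement action digraph $\overrightarrow{\mathrm{DA}}(X,S)$ is a simple graph (that is, its arc set is symmetric) which is regular of valency $|S|$ if and only if $S$ is closed.
   Context: For a set $X$, $\mathrm{Sym}(X)$ is the group of all permutations of $X$, acting on the right: $x^s$ is the image of $x$ under $s$, and $x^{st}=(x^s)^t$. A derangement of $X$ is a permutation of $X$ with no fixed points; $\mathrm{Der}(X)$ is the set of derangements of $X$. For $A,B\subseteq\mathrm{Sym}(X)$, $AB=\{ab : a\in A,b\in B\}$ and $A^{-1}=\{a^{-1}: a\in A\}$; for $x\in X$, $x^A=\{x^a: a\in A\}$; $1$ denotes the identity permutation. A simple digraph is a pair $(X,A)$ with vertex set $X$ and arc set $A\subseteq\{(u,v): u,v\in X, u\neq v\}$. It is regular of valency $k$ if every vertex $x$ has exactly $k$ out-neighbours ($y$ with $(x,y)\in A$) and exactly $k$ in-neighbours ($y$ with $(y,x)\in A$). It is a simple graph if $A$ is symmetric: $(x,y)\in A$ implies $(y,x)\in A$. For non-empty $X$ and non-empty $S\subseteq \mathrm{Der}(X)$, the derangement action digraph $\overrightarrow{\mathrm{DA}}(X,S)$ is the simple digraph with vertex set $X$ and arc set $\{(x,x^s): x\in X, s\in S\}$. When it is a simple graph it is called a derangement action graph. A non-empty subset $S\subseteq\mathrm{Der}(X)$ is closed if both (1) $x^S=x^{S^{-1}}$ for each $x\in X$, and (2) $SS^{-1}\subseteq\mathrm{Der}(X)\cup\{1\}$. *)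

theory Defs
  imports "HOL-Combinatorics.Permutations" "Graph_Theory.Pair_Digraph"
begin

text \<open>
  A permutation of a set \<open>X\<close> (not necessarily finite, not necessarily a whole type) is a function
  \<open>s\<close> with \<open>s permutes X\<close>. Such functions are the identity outside \<open>X\<close>, so equality of functions
  is equality of permutations of \<open>X\<close>, and the identity permutation of \<open>X\<close> is \<open>id\<close>.
  The image of \<open>x\<close> under \<open>s\<close> is \<open>s x\<close>.
\<close>

definition Der :: "'a set \<Rightarrow> ('a \<Rightarrow> 'a) set" where
  "Der X = {s. s permutes X \<and> (\<forall>x\<in>X. s x \<noteq> x)}"

text \<open>
  Permutations act on the right: in the product of \<open>a\<close> and \<open>b\<close> the permutation \<open>a\<close> is applied
  first, which is \<open>b \<circ> a\<close> in function notation.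
\<close>

definition perm_set_mult :: "('a \<Rightarrow> 'a) set \<Rightarrow> ('a \<Rightarrow> 'a) set \<Rightarrow> ('a \<Rightarrow> 'a) set"
    (infixl \<open>\<cdot>\<close> 70) where
  "A \<cdot> B = {b \<circ> a | a b. a \<in> A \<and> b \<in> B}"

definition perm_set_inv :: "('a \<Rightarrow> 'a) set \<Rightarrow> ('a \<Rightarrow> 'a) set" where
  "perm_set_inv A = {inv a | a. a \<in> A}"

definition image_under :: "'a \<Rightarrow> ('a \<Rightarrow> 'a) set \<Rightarrow> 'a set" where
  "image_under x A = {a x | a. a \<in> A}"

definition closed_derangements :: "'a set \<Rightarrow> ('a \<Rightarrow> 'a) set \<Rightarrow> bool" where
  "closed_derangements X S \<longleftrightarrow>
     S \<noteq> {} \<and> S \<subseteq> Der X \<and>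
     (\<forall>x\<in>X. image_under x S = image_under x (perm_set_inv S)) \<and>
     S \<cdot> perm_set_inv S \<subseteq> Der X \<union> {id}"

text \<open>
  Finiteness of the neighbourhoods is required separately because \<open>card\<close> of an infinite set is \<open>0\<close>.
\<close>

definition regular_digraph :: "'a pair_pre_digraph \<Rightarrow> nat \<Rightarrow> bool" where
  "regular_digraph G k \<longleftrightarrow>
     (\<forall>x\<in>pverts G.
        finite {y. (x, y) \<in> parcs G} \<and> card {y. (x, y) \<in> parcs G} = k \<and>
        finite {y. (y, x) \<in> parcs G} \<and> card {y. (y, x) \<in> parcs G} = k)"

definition DA :: "'a set \<Rightarrow> ('a \<Rightarrow> 'a) set \<Rightarrow> 'a pair_pre_digraph" where
  "DA X S = \<lparr>pverts = X, parcs = {(x, s x) | x s. x \<in> X \<and> s \<in> S}\<rparr>"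

text \<open>
  A simple digraph is a \<^const>\<open>pair_loopfree_digraph\<close> (arcs are pairs of distinct vertices;
  no finiteness), and a simple graph is a \<^const>\<open>pair_bidirected_digraph\<close>, which is the same
  together with symmetry of the arc set.
\<close>

lemma pair_loopfree_digraph_DA:
  assumes "S \<subseteq> Der X"
  shows "pair_loopfree_digraph (DA X S)"
  using assms
  by unfold_locales (auto simp: DA_def Der_def permutes_in_image subset_iff, metis)

lemma pair_bidirected_digraph_iff_sym:
  "pair_bidirected_digraph G \<longleftrightarrow> pair_loopfree_digraph G \<and> sym (parcs G)"
  by (auto simp: pair_bidirected_digraph_def pair_sym_digraph_def pair_sym_digraph_axioms_def
      pair_loopfree_digraph_def symmetric_def)

end

theory Submission
  imports Defs
begin

text \<open>
  The out-neighbours of \<open>x\<close> are \<open>x\<^sup>S\<close> and its in-neighbours are the image of \<open>x\<close> under the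
  inverses of \<open>S\<close>, so the first condition of closedness is symmetry of the arc set. For
  \<open>a, b\<close> in \<open>S\<close>, the fixed points of \<open>a b\<^sup>-\<^sup>1\<close> are the points where \<open>a\<close> and \<open>b\<close> agree, so the
  second condition says that evaluation at each \<open>x\<close> is injective on \<open>S\<close>, i.e. that each
  out-neighbourhood has \<open>|S|\<close> elements.
\<close>

lemma image_under_eq_image: "image_under x A = (\<lambda>s. s x) ` A"
  by (auto simp: image_under_def)

lemma Der_permutes: "s \<in> Der X \<Longrightarrow> s permutes X"
  by (simp add: Der_def)

lemma out_neighbours_DA:
  assumes "x \<in> X"
  shows "{y. (x, y) \<in> parcs (DA X S)} = image_under x S"
  using assms by (auto simp: DA_def image_under_def)

text \<open>Each \<open>s\<close> in \<open>S\<close> is a bijection of \<open>X\<close> onto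
  itself, so the only arc that \<open>s\<close> sends into \<open>x\<close> starts at
  \<open>inv s x\<close>.\<close>

lemma in_neighbours_DA:
  assumes "S \<subseteq> Der X" and "x \<in> X"
  shows "{y. (y, x) \<in> parcs (DA X S)} = image_under x (perm_set_inv S)"
proof -
  have "y \<in> X \<and> x = s y \<longleftrightarrow> y = inv s x" if "s \<in> S" for s y
  proof -
    have "s permutes X"
      using that assms(1) Der_permutes by blast
    then show ?thesis
      using assms(2) by (metis permutes_in_image permutes_inverses(1) permutes_inverses(2))
  qed
  then show ?thesis
    by (auto simp: DA_def image_under_def perm_set_inv_def)
qed

lemma sym_parcs_DA_iff:
  assumes "S \<subseteq> Der X"
  shows "sym (parcs (DA X S)) \<longleftrightarrow>
    (\<forall>x\<in>X. image_under x S = image_under x (perm_set_inv S))"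
proof -
  have "sym (parcs (DA X S)) \<longleftrightarrow>
    (\<forall>x\<in>X. {y. (x, y) \<in> parcs (DA X S)} = {y. (y, x) \<in> parcs (DA X S)})"
    (is "_ \<longleftrightarrow> ?R")
  proof
    show "sym (parcs (DA X S)) \<Longrightarrow> ?R"
      by (auto dest: symD)
  next
    assume R: ?R
    show "sym (parcs (DA X S))"
    proof (rule symI)
      fix x y assume xy: "(x, y) \<in> parcs (DA X S)"
      \<comment> \<open>\<open>?R\<close> speaks only of points of \<open>X\<close>, but every arc
        starts there.\<close>
      then have "x \<in> X"
        by (auto simp: DA_def)
      with R xy show "(y, x) \<in> parcs (DA X S)"
        by blast
    qed
  qed
  then show ?thesis
    using assms by (simp add: out_neighbours_DA in_neighbours_DA)
qed

lemma perm_set_mult_inv_subset_Der_iff: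
  assumes "S \<subseteq> Der X"
  shows "S \<cdot> perm_set_inv S \<subseteq> Der X \<union> {id} \<longleftrightarrow> (\<forall>x\<in>X. inj_on (\<lambda>s. s x) S)"
proof -
  have perm: "s permutes X" if "s \<in> S" for s
    using that assms Der_permutes by blast
  have "inv b \<circ> a \<in> Der X \<union> {id} \<longleftrightarrow> (\<forall>x\<in>X. a x = b x \<longrightarrow> a = b)"
    if "a \<in> S" "b \<in> S" for a b
  proof -
    have "inv b \<circ> a permutes X"
      using that perm by (simp add: permutes_compose permutes_inv)
    moreover have fix_iff: "(inv b \<circ> a) x = x \<longleftrightarrow> a x = b x" for x
      using perm[OF that(2)] by (auto simp: permutes_inv_eq)
    \<comment> \<open>\<open>fix_iff\<close> holds at every point, also outside \<open>X\<close>, so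
      it yields equality of functions.\<close>
    moreover have "inv b \<circ> a = id \<longleftrightarrow> a = b"
      using fix_iff by (simp add: fun_eq_iff)
    ultimately show ?thesis
      by (auto simp: Der_def)
  qed
  then have "(\<forall>a\<in>S. \<forall>b\<in>S. inv b \<circ> a \<in> Der X \<union> {id}) \<longleftrightarrow>
      (\<forall>x\<in>X. inj_on (\<lambda>s. s x) S)"
    unfolding inj_on_def by blast
  moreover have "S \<cdot> perm_set_inv S \<subseteq> T \<longleftrightarrow> (\<forall>a\<in>S. \<forall>b\<in>S. inv b \<circ> a \<in> T)" for T
    unfolding perm_set_mult_def perm_set_inv_def by blast
  ultimately show ?thesis
    by simp
qed

text \<open>Symmetry makes in- and out-neighbourhoods coincide, so only the sizes of the images of
  \<open>S\<close> under evaluation matter; as \<open>S\<close> is finite, such an image has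
  \<open>card S\<close> elements exactly when evaluation is injective.\<close>

lemma regular_digraph_DA_iff:
  assumes "S \<subseteq> Der X" and "finite S" and "sym (parcs (DA X S))"
  shows "regular_digraph (DA X S) (card S) \<longleftrightarrow> (\<forall>x\<in>X. inj_on (\<lambda>s. s x) S)"
proof -
  have "image_under x S = image_under x (perm_set_inv S)" if "x \<in> X" for x
    using assms that sym_parcs_DA_iff by blast
  then have "regular_digraph (DA X S) (card S) \<longleftrightarrow>
      (\<forall>x\<in>X. finite (image_under x S) \<and> card (image_under x S) = card S)"
    using assms(1) out_neighbours_DA[of _ X S] in_neighbours_DA[of S X]
    by (auto simp: regular_digraph_def DA_def)
  then show ?thesis
    using assms(2) by (simp add: image_under_eq_image inj_on_iff_eq_card)
qed

theorem theorem1p8: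
  fixes X :: "'a set" and S :: "('a \<Rightarrow> 'a) set"
  assumes "X \<noteq> {}"
    and "S \<subseteq> Der X" and "finite S" and "S \<noteq> {}"
  shows "pair_bidirected_digraph (DA X S) \<and> regular_digraph (DA X S) (card S)
    \<longleftrightarrow> closed_derangements X S"
  \<comment> \<open>The symmetry that \<open>regular_digraph_DA_iff\<close> requires is available
    from either side of the equivalence.\<close>
  using assms pair_loopfree_digraph_DA[OF assms(2)] regular_digraph_DA_iff[OF assms(2,3)]
    sym_parcs_DA_iff[OF assms(2)] perm_set_mult_inv_subset_Der_iff[OF assms(2)]
  by (auto simp: closed_derangements_def pair_bidirected_digraph_iff_sym)

end
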